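(* Let $q$ be prime, let $n,k\ge1$ be integers, and let $\boldsymbol\alpha\in\mathbb{F}_q^n$ have distinct nonzero entries. Then the code $\mathrm{GRS}_{q,k}(\boldsymbol\alpha,\boldsymbol\alpha)\subseteq\mathbb{F}_q^n$, of rate $R=k/n$, has squared $\ell_2$ minimum distance at least $$\frac{(n+1)^2-k^2}{12k^2}\cdot(n+1)\;>\;\frac{1-R^2}{12R^2}\cdot n .$$
   Context: $\mathrm{GRS}_{q,k}(\boldsymbol\alpha,\mathbf{t})=\{(t_1g(\alpha_1),\dots,t_ng(\alpha_n)):g\in\mathbb{F}_q[x],\ \deg g<k\}$ is the generalized Reed–Solomon code with evaluation points $\boldsymbol\alpha$ (distinct entries) and twist factors $\mathbf{t}$ (nonzero entries); here $\mathbf{t}=\boldsymbol\alpha$. Identify $\mathbb{F}_q=\mathbb{Z}/q\mathbb{Z}$; for $x\in\mathbb{F}_q$, $\overline{x}$ is its unique integer representative in $[-q/2,q/2)$, and $\|\mathbf{x}\|_2=\big(\sum_i|\overline{x_i}|^2\big)^{1/2}$ for $\mathbf{x}\in\mathbb{F}_q^n$. The $\ell_2$ minimum distance of a linear code is the minimum of $\|\mathbf{c}\|_2$ over its nonzero codewords $\mathbf{c}$.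
   Formalization: The rate R = k/n and the strict inequality are stated only for k ≤ n, since for k > n the rate cannot be k/n and the inequality can fail (e.g. n = 1, k = 3); the distance bound is kept for all k ≥ 1. *)

theory Defs
  imports "HOL-Analysis.Analysis" "Berlekamp_Zassenhaus.Finite_Field"
begin

text \<open>
  For \<open>'q :: prime_card\<close> the type \<open>'q mod_ring\<close> is the ring of integers modulo the prime
  \<open>q = CARD('q)\<close>; words of length \<open>n = CARD('n)\<close> are elements of \<open>'q mod_ring ^ 'n\<close>.
\<close>

text \<open>The disjunct \<open>g = 0\<close> reflects the convention that the zero polynomial has degree minus
  infinity; it only matters for \<open>k = 0\<close>, because in the library \<open>degree 0 = 0\<close>.\<close>

definition GRS :: "nat \<Rightarrow> 'a::field ^ 'n \<Rightarrow> 'a ^ 'n \<Rightarrow> ('a ^ 'n) set" where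
  "GRS k \<alpha> t = {(\<chi> i. t $ i * poly g (\<alpha> $ i)) | g. g = 0 \<or> degree g < k}"

lemma subspace_GRS: "vec.subspace (GRS k \<alpha> t)"
proof (rule vec.subspaceI)
  show "0 \<in> GRS k \<alpha> t"
    unfolding GRS_def by (auto simp: vec_eq_iff intro!: exI[of _ 0])
next
  fix x y assume "x \<in> GRS k \<alpha> t" "y \<in> GRS k \<alpha> t"
  then obtain g h where "x = (\<chi> i. t $ i * poly g (\<alpha> $ i))" "g = 0 \<or> degree g < k"
    "y = (\<chi> i. t $ i * poly h (\<alpha> $ i))" "h = 0 \<or> degree h < k"
    unfolding GRS_def by blast
  then show "x + y \<in> GRS k \<alpha> t"
    unfolding GRS_def
    by (auto simp: vec_eq_iff algebra_simps intro!: exI[of _ "g + h"] degree_add_less)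
next
  fix c x assume "x \<in> GRS k \<alpha> t"
  then obtain g where "x = (\<chi> i. t $ i * poly g (\<alpha> $ i))" "g = 0 \<or> degree g < k"
    unfolding GRS_def by blast
  then show "c *s x \<in> GRS k \<alpha> t"
    unfolding GRS_def
    by (auto simp: vec_eq_iff algebra_simps intro!: exI[of _ "Polynomial.smult c g"]
        intro: le_less_trans[OF degree_smult_le])
qed

text \<open>Intended for linear codes, i.e. subspaces \<open>C\<close>.\<close>

definition rate :: "('a::field ^ 'n) set \<Rightarrow> real" where
  "rate C = real (vec.dim C) / real CARD('n)"

definition centered_rep :: "'q::prime_card mod_ring \<Rightarrow> int" where
  "centered_rep x = (THE z. of_int z = x \<and>
     - real CARD('q) / 2 \<le> real_of_int z \<and> real_of_int z < real CARD('q) / 2)"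

lemma centered_rep_ex1:
  fixes x :: "'q::prime_card mod_ring"
  shows "\<exists>!z. of_int z = x \<and>
     - real CARD('q) / 2 \<le> real_of_int z \<and> real_of_int z < real CARD('q) / 2"
proof (rule ex_ex1I)
  define r where "r = to_int_mod_ring x"
  have r: "0 \<le> r" "r < int CARD('q)"
    using range_to_int_mod_ring[where 'a = 'q] unfolding r_def by (metis atLeastLessThan_iff rangeI)+
  have ofr: "of_int r = x"
    by (simp add: r_def of_int_of_int_mod_ring)
  have ofq: "(of_int (int CARD('q)) :: 'q mod_ring) = 0"
    by (simp add: of_int_of_int_mod_ring, transfer, simp)
  have rr: "0 \<le> real_of_int r" "real_of_int r < real CARD('q)"
    using r by linarith+
  show "\<exists>z. of_int z = x \<and>
     - real CARD('q) / 2 \<le> real_of_int z \<and> real_of_int z < real CARD('q) / 2"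
  proof (cases "real_of_int r < real CARD('q) / 2")
    case True
    with ofr rr show ?thesis by (intro exI[of _ r]) auto
  next
    case False
    with ofr ofq rr show ?thesis by (intro exI[of _ "r - int CARD('q)"]) auto
  qed
next
  fix y z
  assume y: "of_int y = x \<and>
     - real CARD('q) / 2 \<le> real_of_int y \<and> real_of_int y < real CARD('q) / 2"
  assume z: "of_int z = x \<and>
     - real CARD('q) / 2 \<le> real_of_int z \<and> real_of_int z < real CARD('q) / 2"
  have "(of_int_mod_ring y :: 'q mod_ring) = of_int_mod_ring z"
    using y z by (simp add: of_int_of_int_mod_ring)
  then have "y mod int CARD('q) = z mod int CARD('q)"
    by (transfer, simp)
  then have "int CARD('q) dvd y - z"
    by (simp add: mod_eq_dvd_iff)
  moreover have "\<bar>y - z\<bar> < int CARD('q)"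
    using y z by linarith
  ultimately show "y = z"
    by (metis dvd_imp_le_int abs_of_nat eq_iff_diff_eq_0 not_le)
qed

definition l2_norm :: "'q::prime_card mod_ring ^ 'n \<Rightarrow> real" where
  "l2_norm x = sqrt (\<Sum>i\<in>UNIV. \<bar>real_of_int (centered_rep (x $ i))\<bar>\<^sup>2)"

text \<open>The set of norms is finite, because the ambient space is; for the zero code it is
  empty and the minimum is unspecified.\<close>

definition l2_min_dist :: "('q::prime_card mod_ring ^ 'n) set \<Rightarrow> real" where
  "l2_min_dist C = Min (l2_norm ` (C - {0}))"

end

theory Submission
  imports Defs
begin

text \<open>
  A nonzero codeword is the restriction of \<open>f = X g\<close> to the evaluation points, where \<open>f\<close> is
  nonconstant of degree at most \<open>k\<close>. Adjoining the evaluation point \<open>0\<close>, where \<open>f\<close> vanishes,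
  does not change the norm and gives \<open>N = n + 1\<close> integers, each value occurring at most \<open>k\<close>
  times. Their sum of squares is smallest when they are packed around \<open>0\<close>. The resulting bound
  is obtained by linear programming duality: with \<open>r\<close> the integer such that
  \<open>(2r - 1) k \<le> N < (2r + 1) k\<close>, the sum of \<open>a\<^sup>2 - r\<^sup>2\<close> over the \<open>N\<close> integers is at least \<open>k\<close> times
  the sum of \<open>v\<^sup>2 - r\<^sup>2\<close> over \<open>\<bar>v\<bar> \<le> r\<close>.
\<close>

text \<open>The constant \<open>c\<close> is kept separate from \<open>r\<close> so that the summand
  stays fixed during the induction, which adds the two end terms. The use below takes
  \<open>c\<close> to be the square of \<open>r\<close>.\<close>

lemma sum_const_minus_squares:
  fixes c :: real
  shows "(\<Sum>v=-int r..int r. c - (real_of_int v)\<^sup>2)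
    = (2 * real r + 1) * c - real r * (real r + 1) * (2 * real r + 1) / 3"
proof (induction r)
  case 0
  show ?case by simp
next
  case (Suc r)
  have "{-int (Suc r)..int (Suc r)} = insert (int (Suc r)) (insert (-int (Suc r)) {-int r..int r})"
    by auto
  then have "(\<Sum>v=-int (Suc r)..int (Suc r). c - (real_of_int v)\<^sup>2)
      = 2 * (c - (real r + 1)\<^sup>2) + (\<Sum>v=-int r..int r. c - (real_of_int v)\<^sup>2)"
    by (simp add: power2_eq_square algebra_simps)
  then show ?case
    unfolding Suc.IH by (simp add: field_simps power2_eq_square)
qed

lemma sum_squares_ge_of_card_fibres_le:
  fixes a :: "'b \<Rightarrow> int"
  assumes "finite A" and "k \<ge> 1"
    and fibre: "\<And>v. card {x \<in> A. a x = v} \<le> k"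
  shows "((real (card A))\<^sup>2 - (real k)\<^sup>2) / (12 * (real k)\<^sup>2) * real (card A)
    \<le> (\<Sum>x\<in>A. (real_of_int (a x))\<^sup>2)"
proof -
  define N K where "N = real (card A)" and "K = real k"
  \<comment> \<open>For \<open>r\<close> at least 1, an optimal packing takes each value with
    \<open>\<bar>v\<bar> < r\<close> exactly \<open>k\<close> times, which uses
    \<open>(2r - 1) k\<close> points, and puts the fewer than \<open>2k\<close> remaining points at
    \<open>r\<close> or \<open>-r\<close>. So \<open>r\<close> squared is the marginal cost of a
    point and serves as the dual multiplier.\<close>
  define r where "r = nat \<lfloor>(N / K + 1) / 2\<rfloor>"
  define B where "B = {x \<in> A. \<bar>a x\<bar> \<le> int r}"
  have K: "K > 0" and N: "N \<ge> 0"
    using \<open>k \<ge> 1\<close> by (auto simp: N_def K_def)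
  have r_floor: "real r = of_int \<lfloor>(N / K + 1) / 2\<rfloor>"
    using K N unfolding r_def by (subst of_nat_nat) auto
  have r: "2 * real r - 1 \<le> N / K" "N / K < 2 * real r + 1"
    using of_int_floor_le[of "(N / K + 1) / 2"] real_of_int_floor_add_one_gt[of "(N / K + 1) / 2"]
    unfolding r_floor by argo+
  have rN: "(2 * real r - 1) * K \<le> N" "N < (2 * real r + 1) * K"
    using r K by (simp_all add: field_simps)
  have "finite B"
    using \<open>finite A\<close> by (simp add: B_def)
  have "(\<Sum>x\<in>A. (real r)\<^sup>2 - (real_of_int (a x))\<^sup>2) \<le> (\<Sum>x\<in>B. (real r)\<^sup>2 - (real_of_int (a x))\<^sup>2)"
  proof -
    have "(real r)\<^sup>2 - (real_of_int (a x))\<^sup>2 \<le> 0" if "x \<in> A - B" for x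
    proof -
      have "real r \<le> \<bar>real_of_int (a x)\<bar>"
        using that by (auto simp: B_def)
      then show ?thesis
        using power_mono[of "real r" "\<bar>real_of_int (a x)\<bar>" 2] by simp
    qed
    then have "(\<Sum>x\<in>A - B. (real r)\<^sup>2 - (real_of_int (a x))\<^sup>2) \<le> 0"
      by (rule sum_nonpos)
    moreover have "B \<subseteq> A"
      by (auto simp: B_def)
    ultimately show ?thesis
      using sum.subset_diff[of B A "\<lambda>x. (real r)\<^sup>2 - (real_of_int (a x))\<^sup>2"] \<open>finite A\<close> by simp
  qed
  also have "\<dots> = (\<Sum>v=-int r..int r. \<Sum>x\<in>{x \<in> B. a x = v}. (real r)\<^sup>2 - (real_of_int (a x))\<^sup>2)"
    using \<open>finite B\<close> by (intro sum.group[symmetric]) (auto simp: B_def)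
  also have "\<dots> = (\<Sum>v=-int r..int r. real (card {x \<in> B. a x = v}) * ((real r)\<^sup>2 - (real_of_int v)\<^sup>2))"
    by (intro sum.cong) auto
  also have "\<dots> \<le> (\<Sum>v=-int r..int r. K * ((real r)\<^sup>2 - (real_of_int v)\<^sup>2))"
  proof (intro sum_mono mult_right_mono)
    fix v assume v: "v \<in> {-int r..int r}"
    have "card {x \<in> B. a x = v} \<le> card {x \<in> A. a x = v}"
      using \<open>finite A\<close> by (intro card_mono) (auto simp: B_def)
    with fibre[of v] show "real (card {x \<in> B. a x = v}) \<le> K"
      unfolding K_def by linarith
    have "\<bar>real_of_int v\<bar> \<le> real r"
      using v by auto
    then show "0 \<le> (real r)\<^sup>2 - (real_of_int v)\<^sup>2"
      using power_mono[of "\<bar>real_of_int v\<bar>" "real r" 2] by simp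
  qed
  also have "\<dots> = K * ((2 * real r + 1) * (real r)\<^sup>2 - real r * (real r + 1) * (2 * real r + 1) / 3)"
    by (simp only: sum_distrib_left[symmetric] sum_const_minus_squares)
  finally have sum_ge: "N * (real r)\<^sup>2
      - K * ((2 * real r + 1) * (real r)\<^sup>2 - real r * (real r + 1) * (2 * real r + 1) / 3)
    \<le> (\<Sum>x\<in>A. (real_of_int (a x))\<^sup>2)"
    by (simp add: sum_subtractf N_def)
  \<comment> \<open>The dual bound is linear in \<open>N\<close>: it is the chord of the cubic
    \<open>(N^3 - K^2 N) / (12 K^2)\<close> between \<open>N = (2r - 1) K\<close> and
    \<open>N = (2r + 1) K\<close>. Their difference therefore has these two roots, and the third is
    \<open>-4rK\<close> because there is no quadratic term. Between the first two roots, the chord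
    lies above the cubic.\<close>
  have "0 \<le> (N - (2 * real r - 1) * K) * ((2 * real r + 1) * K - N) * (N + 4 * real r * K)"
    using rN K N by (intro mult_nonneg_nonneg) auto
  also have "\<dots> = 12 * K\<^sup>2 * (N * (real r)\<^sup>2
      - K * ((2 * real r + 1) * (real r)\<^sup>2 - real r * (real r + 1) * (2 * real r + 1) / 3))
      - (N\<^sup>2 - K\<^sup>2) * N"
    by (simp add: field_simps power2_eq_square)
  finally have "(N\<^sup>2 - K\<^sup>2) / (12 * K\<^sup>2) * N \<le> N * (real r)\<^sup>2
      - K * ((2 * real r + 1) * (real r)\<^sup>2 - real r * (real r + 1) * (2 * real r + 1) / 3)"
    using K by (simp add: field_simps)
  with sum_ge show ?thesis
    unfolding N_def K_def by linarith
qed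

lemma of_int_centered_rep: "of_int (centered_rep x) = x"
  using theI'[OF centered_rep_ex1[of x]] unfolding centered_rep_def by blast

lemma centered_rep_0 [simp]: "centered_rep 0 = 0"
  unfolding centered_rep_def by (rule the1_equality[OF centered_rep_ex1]) auto

text \<open>A fibre over \<open>v\<close> is the root set of \<open>f - [:v:]\<close>, which is
  nonzero because \<open>f\<close> is not constant.\<close>

lemma card_poly_fibre_le_degree:
  fixes f :: "'a::idom poly"
  assumes "degree f > 0"
  shows "card {x. poly f x = v} \<le> degree f"
proof -
  have "f - [:v:] \<noteq> 0"
    using assms by auto
  moreover have "{x. poly f x = v} = {x. poly (f - [:v:]) x = 0}"
    by auto
  ultimately have "card {x. poly f x = v} \<le> degree (f - [:v:])"
    using poly_roots_degree by metis
  then show ?thesis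
    using degree_diff_le_max[of f "[:v:]"] by simp
qed

text \<open>The codeword can be zero only if \<open>g\<close> has \<open>n\<close> roots; then
  \<open>k\<close> is at least \<open>n + 1\<close> and the left side is at most 0, so the bound is
  consistent.\<close>

lemma l2_norm_codeword_ge:
  fixes \<alpha> :: "'q::prime_card mod_ring ^ 'n"
  assumes inj: "inj (\<lambda>i. \<alpha> $ i)" and nz: "\<And>i. \<alpha> $ i \<noteq> 0"
    and "g \<noteq> 0" and "degree g < k"
  defines "n \<equiv> real CARD('n)"
  shows "((n + 1)\<^sup>2 - (real k)\<^sup>2) / (12 * (real k)\<^sup>2) * (n + 1)
    \<le> (l2_norm (\<chi> i. \<alpha> $ i * poly g (\<alpha> $ i)))\<^sup>2"
proof -
  \<comment> \<open>This is \<open>X g\<close>: the twist factors equal to the evaluation points are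
    absorbed into the polynomial.\<close>
  define f where "f = pCons 0 g"
  define a where "a x = centered_rep (poly f x)" for x
  define A where "A = insert 0 (range (\<lambda>i. \<alpha> $ i))"
  have deg: "degree f > 0" "degree f \<le> k"
    using \<open>g \<noteq> 0\<close> \<open>degree g < k\<close> by (auto simp: f_def)
  have zero: "0 \<notin> range (\<lambda>i. \<alpha> $ i)"
    using nz by (metis imageE)
  have cardA: "real (card A) = n + 1"
    using zero inj by (simp add: A_def n_def card_image)
  have "card {x \<in> A. a x = v} \<le> k" for v
  proof -
    \<comment> \<open>Centered representatives determine residues, so a fibre of \<open>a\<close>
      lies in a fibre of \<open>f\<close>.\<close>
    have "{x \<in> A. a x = v} \<subseteq> {x. poly f x = of_int v}"
      by (auto simp: a_def of_int_centered_rep)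
    then have "card {x \<in> A. a x = v} \<le> card {x. poly f x = of_int v}"
      by (intro card_mono) auto
    then show ?thesis
      using card_poly_fibre_le_degree[OF deg(1), of "of_int v"] deg(2) by linarith
  qed
  then have "((n + 1)\<^sup>2 - (real k)\<^sup>2) / (12 * (real k)\<^sup>2) * (n + 1) \<le> (\<Sum>x\<in>A. (real_of_int (a x))\<^sup>2)"
    using sum_squares_ge_of_card_fibres_le[of A k a] deg cardA by (simp add: A_def)
  also have "\<dots> = (\<Sum>i\<in>UNIV. (real_of_int (a (\<alpha> $ i)))\<^sup>2)"
    using zero inj by (simp add: A_def sum.reindex a_def f_def)
  also have "\<dots> = (l2_norm (\<chi> i. \<alpha> $ i * poly g (\<alpha> $ i)))\<^sup>2"
    by (simp add: l2_norm_def a_def f_def sum_nonneg)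
  finally show ?thesis .
qed

text \<open>Since the twist factors are nonzero, all the evaluation points are roots of
  \<open>g\<close>, more than its degree allows.\<close>

lemma poly_eq_0_of_vanishing_codeword:
  fixes \<alpha> :: "'a::field ^ 'n"
  assumes inj: "inj (\<lambda>i. \<alpha> $ i)" and nz: "\<And>i. \<alpha> $ i \<noteq> 0"
    and "degree g < CARD('n)"
    and "(\<chi> i. \<alpha> $ i * poly g (\<alpha> $ i)) = 0"
  shows "g = 0"
proof (rule ccontr)
  assume "g \<noteq> 0"
  have "range (\<lambda>i. \<alpha> $ i) \<subseteq> {x. poly g x = 0}"
    using assms(4) nz by (auto simp: vec_eq_iff)
  then have "card (range (\<lambda>i. \<alpha> $ i)) \<le> card {x. poly g x = 0}"
    by (intro card_mono poly_roots_finite \<open>g \<noteq> 0\<close>)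
  also have "\<dots> \<le> degree g"
    by (rule poly_roots_degree[OF \<open>g \<noteq> 0\<close>])
  finally show False
    using \<open>degree g < CARD('n)\<close> inj by (simp add: card_image)
qed

text \<open>The codewords of the monomials of degree below \<open>k\<close> form a basis; this
  identifies the rate with \<open>k / n\<close>.\<close>

lemma dim_GRS:
  fixes \<alpha> :: "'a::field ^ 'n"
  assumes inj: "inj (\<lambda>i. \<alpha> $ i)" and nz: "\<And>i. \<alpha> $ i \<noteq> 0"
    and k: "1 \<le> k" "k \<le> CARD('n)"
  shows "vec.dim (GRS k \<alpha> \<alpha>) = k"
proof -
  define cw where "cw g = (\<chi> i. \<alpha> $ i * poly g (\<alpha> $ i))" for g
  define b where "b j = cw (Polynomial.monom 1 j)" for j
  have deg_sum: "degree (\<Sum>j<k. Polynomial.monom (c j) j) < k" for c :: "nat \<Rightarrow> 'a"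
    using k by (intro degree_sum_less) (auto intro: le_less_trans[OF degree_monom_le])
  have cw_sum: "cw (\<Sum>j<k. Polynomial.monom (c j) j) = (\<Sum>j<k. c j *s b j)" for c
    by (simp add: cw_def b_def vec_eq_iff poly_sum poly_monom sum_distrib_left mult.left_commute)
  have coeffs: "c j = 0" if "(\<Sum>j<k. c j *s b j) = 0" "j < k" for c j
  proof -
    have "(\<Sum>j<k. Polynomial.monom (c j) j) = 0"
      using that(1) k deg_sum[of c] unfolding cw_sum[symmetric] cw_def
      by (intro poly_eq_0_of_vanishing_codeword[OF inj nz]) auto
    then have "Polynomial.coeff (\<Sum>j<k. Polynomial.monom (c j) j) j = 0"
      by simp
    then show ?thesis
      using \<open>j < k\<close> by (simp add: coeff_sum)
  qed
  have inj_b: "inj_on b {..<k}"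
  proof (rule inj_onI, rule ccontr)
    fix i j assume ij: "i \<in> {..<k}" "j \<in> {..<k}" "b i = b j" "i \<noteq> j"
    \<comment> \<open>A coincidence \<open>b i = b j\<close> is itself a vanishing combination, with
      coefficient 1 at \<open>i\<close> and -1 at \<open>j\<close>.\<close>
    define c :: "nat \<Rightarrow> 'a" where "c l = (if l = i then 1 else 0) - (if l = j then 1 else 0)" for l
    have "(\<Sum>l<k. c l *s b l) = 0"
      using ij by (simp add: c_def vec.scale_left_diff_distrib sum_subtractf if_distrib[of "\<lambda>x. x *s _"]
          cong: if_cong)
    from coeffs[OF this, of i] ij show False
      by (simp add: c_def)
  qed
  have "vec.independent (b ` {..<k})"
  proof (rule vec.independent_if_scalars_zero)
    fix u x assume "(\<Sum>x\<in>b ` {..<k}. u x *s x) = 0" "x \<in> b ` {..<k}"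
    then show "u x = 0"
      using coeffs[of "\<lambda>j. u (b j)"] by (auto simp: sum.reindex[OF inj_b])
  qed simp
  moreover have "GRS k \<alpha> \<alpha> \<subseteq> vec.span (b ` {..<k})"
  proof
    fix x assume "x \<in> GRS k \<alpha> \<alpha>"
    then obtain g where "x = cw g" "g = 0 \<or> degree g < k"
      unfolding GRS_def cw_def by blast
    then have g: "x = cw g" "degree g < k"
      using k by auto
    have "(\<Sum>j<k. Polynomial.monom (Polynomial.coeff g j) j) = g"
      using g(2) by (intro poly_eqI) (auto simp: coeff_sum coeff_eq_0)
    then have "x = (\<Sum>j<k. Polynomial.coeff g j *s b j)"
      using g(1) cw_sum[of "Polynomial.coeff g"] by metis
    moreover have "(\<Sum>j<k. Polynomial.coeff g j *s b j) \<in> vec.span (b ` {..<k})"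
      by (rule vec.span_sum, rule vec.span_scale, rule vec.span_base, rule imageI)
    ultimately show "x \<in> vec.span (b ` {..<k})"
      by simp
  qed
  moreover have "b ` {..<k} \<subseteq> GRS k \<alpha> \<alpha>"
  proof
    fix x assume "x \<in> b ` {..<k}"
    then obtain j where "j < k" "x = b j"
      by blast
    then show "x \<in> GRS k \<alpha> \<alpha>"
      unfolding GRS_def b_def cw_def
      by (intro CollectI exI[of _ "Polynomial.monom 1 j"]) (simp add: degree_monom_eq)
  qed
  ultimately show ?thesis
    using vec.dim_unique[of "b ` {..<k}"] inj_b by (simp add: card_image)
qed

theorem lemma5p7:
  fixes \<alpha> :: "'q::prime_card mod_ring ^ 'n" and n k :: nat
  assumes "n = CARD('n)"
    and "k \<ge> 1"
    and "inj (\<lambda>i. \<alpha> $ i)"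
    and "\<And>i. \<alpha> $ i \<noteq> 0"
  shows "(l2_min_dist (GRS k \<alpha> \<alpha>))\<^sup>2
           \<ge> ((real n + 1)\<^sup>2 - (real k)\<^sup>2) / (12 * (real k)\<^sup>2) * (real n + 1)
       \<and> (k \<le> n \<longrightarrow>
            (let R = real k / real n in
               rate (GRS k \<alpha> \<alpha>) = R
             \<and> ((real n + 1)\<^sup>2 - (real k)\<^sup>2) / (12 * (real k)\<^sup>2) * (real n + 1)
                 > (1 - R\<^sup>2) / (12 * R\<^sup>2) * real n))"
proof (intro conjI impI)
  define C where "C = GRS k \<alpha> \<alpha>"
  \<comment> \<open>The codeword of the constant 1 is \<open>\<alpha>\<close> itself, so the minimum
    is over a nonempty set and is attained.\<close>
  have "(\<chi> i. \<alpha> $ i * poly 1 (\<alpha> $ i)) \<in> C"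
    unfolding C_def GRS_def using assms(2) by (intro CollectI exI[of _ 1]) auto
  moreover have "(\<chi> i. \<alpha> $ i * poly 1 (\<alpha> $ i)) \<noteq> 0"
    using assms(4) by (auto simp: vec_eq_iff)
  ultimately have "C - {0} \<noteq> {}"
    by blast
  then have "l2_min_dist C \<in> l2_norm ` (C - {0})"
    unfolding l2_min_dist_def by (intro Min_in) auto
  then obtain g where g: "g = 0 \<or> degree g < k" "(\<chi> i. \<alpha> $ i * poly g (\<alpha> $ i)) \<noteq> 0"
    and min: "l2_min_dist C = l2_norm (\<chi> i. \<alpha> $ i * poly g (\<alpha> $ i))"
    by (auto simp: C_def GRS_def)
  have "g \<noteq> 0"
    using g(2) by (auto simp: vec_eq_iff)
  with g(1) show "(l2_min_dist (GRS k \<alpha> \<alpha>))\<^sup>2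
      \<ge> ((real n + 1)\<^sup>2 - (real k)\<^sup>2) / (12 * (real k)\<^sup>2) * (real n + 1)"
    using l2_norm_codeword_ge[OF assms(3,4), of g k] min assms(1) by (simp add: C_def)
next
  assume "k \<le> n"
  have k: "real k > 0" and n: "real n > 0"
    using \<open>k \<ge> 1\<close> \<open>k \<le> n\<close> by auto
  \<comment> \<open>The rate form is the bound with \<open>n\<close> in place of
    \<open>n + 1\<close>. Enlarging the outer factor may give equality, as when
    \<open>k = n\<close>; strictness comes from enlarging the square.\<close>
  have "(1 - (real k / real n)\<^sup>2) / (12 * (real k / real n)\<^sup>2) * real n
      = ((real n)\<^sup>2 - (real k)\<^sup>2) / (12 * (real k)\<^sup>2) * real n"
    using k n by (simp add: field_simps)
  also have "\<dots> \<le> ((real n)\<^sup>2 - (real k)\<^sup>2) / (12 * (real k)\<^sup>2) * (real n + 1)"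
    using \<open>k \<le> n\<close> by (intro mult_left_mono divide_nonneg_nonneg) auto
  also have "\<dots> < ((real n + 1)\<^sup>2 - (real k)\<^sup>2) / (12 * (real k)\<^sup>2) * (real n + 1)"
    using k n by (intro mult_strict_right_mono divide_strict_right_mono)
      (auto simp: power2_eq_square algebra_simps)
  finally show "let R = real k / real n in
      rate (GRS k \<alpha> \<alpha>) = R
    \<and> ((real n + 1)\<^sup>2 - (real k)\<^sup>2) / (12 * (real k)\<^sup>2) * (real n + 1)
        > (1 - R\<^sup>2) / (12 * R\<^sup>2) * real n"
    using dim_GRS[OF assms(3,4), of k] assms(1,2) \<open>k \<le> n\<close> by (simp add: rate_def Let_def)
qed

end
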